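(* Let $\mathcal{F}\subset\mathbb{R}^d$ be a convex feasible set with bounded diameter $D_\infty$, i.e. $\|x-y\|_\infty\le D_\infty$ for all $x,y\in\mathcal{F}$. Let $f_1,\dots,f_T:\mathbb{R}^d\to\mathbb{R}$ be convex differentiable functions, and let $\theta^*\in\arg\min_{\theta\in\mathcal{F}}\sum_{t=1}^T f_t(\theta)$. Consider the AdaBelief iteration (without bias correction): starting from $\theta_1\in\mathcal{F}$, $m_0=0$, $s_0=0$, for $t=1,\dots,T$, $$g_t=\nabla f_t(\theta_t),\quad m_t=\beta_{1t}m_{t-1}+(1-\beta_{1t})g_t,\quad s_t=\beta_2 s_{t-1}+(1-\beta_2)(g_t-m_t)^2,$$ $$\theta_{t+1}=\Pi_{\mathcal{F},\sqrt{s_t}}\big(\theta_t-\alpha_t s_t^{-1/2}m_t\big),$$ where all operations on vectors are elementwise, $\Pi_{\mathcal{F},M}(y)=\arg\min_{x\in\mathcal{F}}\|M^{1/2}(x-y)\|$ (with $\sqrt{s_t}$ interpreted as the diagonal matrix with entries $\sqrt{s_{t,i}}$), and any small constant $\epsilon$ is regarded as absorbed into $s_t$. Assume $0\le\beta_2<1$, $\alpha_t=\alpha/\sqrt{t}$ with $\alpha>0$, $\beta_{11}=\beta_1$, $0\le\beta_{1t}\le\beta_1<1$, and $s_t\le s_{t+1}$ (elementwise) for all $t\in[T]$. Assume $\|g_t\|_\infty\le G_\infty/2$ (hence $\|g_t-m_t\|_\infty\le G_\infty$) and $s_{t,i}\ge c>0$ for all $t\in[T]$ and $i\in[d]$. Then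 $$\sum_{t=1}^T[f_t(\theta_t)-f_t(\theta^* )]\le \frac{D_\infty^2\sqrt{T}}{2\alpha(1-\beta_1)}\sum_{i=1}^d s_{T,i}^{1/2}+\frac{(1+\beta_1)\alpha\sqrt{1+\log T}}{2\sqrt{c}(1-\beta_1)^3}\sum_{i=1}^d\big\|g_{1:T,i}^2\big\|_2+\frac{D_\infty^2}{2(1-\beta_1)}\sum_{t=1}^T\sum_{i=1}^d\frac{\beta_{1t}s_{t,i}^{1/2}}{\alpha_t}.$$
   Context: $g_{t,i}$ and $s_{t,i}$ denote the $i$-th coordinates of $g_t$ and $s_t$; $g_{1:T,i}^2$ denotes the vector $(g_{1,i}^2,\dots,g_{T,i}^2)\in\mathbb{R}^T$, and $\|\cdot\|_2$ is the Euclidean norm. *)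

theory Defs
  imports "HOL-Analysis.Analysis"
begin

text \<open>Weighted projection: x is a minimiser over F of
  \<Sum>i. w_i (x_i - y_i)^2, i.e. of the squared norm of M^(1/2)(x-y) with M = diag w.\<close>
definition is_wproj :: "(real^'d) set \<Rightarrow> real^'d \<Rightarrow> real^'d \<Rightarrow> real^'d \<Rightarrow> bool" where
  "is_wproj F w y x \<longleftrightarrow> x \<in> F \<and>
     (\<forall>z\<in>F. (\<Sum>i\<in>UNIV. w$i * (x$i - y$i)^2) \<le> (\<Sum>i\<in>UNIV. w$i * (z$i - y$i)^2))"

end

theory Submission
  imports Defs
begin

text \<open>Write \<open>x\<^sub>t = \<theta>\<^sub>t - \<theta>*\<close>. The usual route divides the projection inequality by \<open>1 - \<beta>\<^sub>1\<^sub>t\<close>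
  before telescoping, which would need \<open>\<beta>\<^sub>1\<^sub>t\<close> to be monotone. Instead we write
  \<open>g\<^sub>t = m\<^sub>t + \<beta>\<^sub>1\<^sub>t (g\<^sub>t - m\<^sub>t\<^sub>-\<^sub>1)\<close>: the part \<open>\<langle>m\<^sub>t, x\<^sub>t\<rangle>\<close> telescopes with the monotone weights
  \<open>\<surd>s\<^sub>t / \<alpha>\<^sub>t\<close>, and Young's inequality applied to the remainder produces the third term of the bound
  together with a multiple of \<open>\<beta>\<^sub>1\<^sub>t (1 - \<beta>\<^sub>1\<^sub>t) (g\<^sub>t - m\<^sub>t\<^sub>-\<^sub>1)\<^sup>2\<close>. The latter adds up with \<open>m\<^sub>t\<^sup>2\<close> to exactly
  \<open>\<beta>\<^sub>1\<^sub>t m\<^sub>t\<^sub>-\<^sub>1\<^sup>2 + (1 - \<beta>\<^sub>1\<^sub>t) g\<^sub>t\<^sup>2\<close>, whose squares have a sum controlled by \<open>\<Sum> g\<^sub>t\<^sup>4\<close>;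
  Cauchy-Schwarz against \<open>\<Sum> 1/t \<le> 1 + ln T\<close> gives the second term.\<close>

section \<open>Tangent inequality and weighted projections\<close>

lemma convex_on_ge_tangent:
  fixes f :: "'a::real_inner \<Rightarrow> real"
  assumes "convex_on UNIV f" and "(f has_derivative (\<lambda>h. g \<bullet> h)) (at x)"
  shows "f x - f y \<le> g \<bullet> (x - y)"
proof -
  \<comment> \<open>Restriction to the line through \<open>x\<close> and \<open>y\<close>, with
    \<open>\<phi> 0 = f x\<close> and \<open>\<phi> 1 = f y\<close>, reduces the claim to the
    one-variable tangent inequality at 0.\<close>
  define \<phi> where "\<phi> u = f (x + u *\<^sub>R (y - x))" for u :: real
  have "convex_on UNIV \<phi>"
  proof (rule convex_onI)
    fix t u v :: real assume t: "0 < t" "t < 1"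
    have "x + ((1 - t) *\<^sub>R u + t *\<^sub>R v) *\<^sub>R (y - x)
        = (1 - t) *\<^sub>R (x + u *\<^sub>R (y - x)) + t *\<^sub>R (x + v *\<^sub>R (y - x))"
      by (simp add: algebra_simps)
    then show "\<phi> ((1 - t) *\<^sub>R u + t *\<^sub>R v) \<le> (1 - t) * \<phi> u + t * \<phi> v"
      unfolding \<phi>_def using convex_onD[OF assms(1)] t by simp
  qed simp
  moreover have "(\<phi> has_derivative (\<lambda>u. g \<bullet> (u *\<^sub>R (y - x)))) (at 0)"
  proof -
    have "((\<lambda>u. x + u *\<^sub>R (y - x)) has_derivative (\<lambda>u. u *\<^sub>R (y - x))) (at (0::real))"
      by (auto intro!: derivative_eq_intros)
    moreover have "(f has_derivative (\<lambda>h. g \<bullet> h)) (at (x + 0 *\<^sub>R (y - x)))"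
      using assms(2) by simp
    ultimately show ?thesis
      unfolding \<phi>_def by (rule has_derivative_compose)
  qed
  then have "(\<phi> has_field_derivative (g \<bullet> (y - x))) (at 0)"
    by (simp add: has_field_derivative_def mult_commute_abs)
  ultimately have "\<phi> 1 - \<phi> 0 \<ge> (g \<bullet> (y - x)) * (1 - 0)"
    by (intro convex_on_imp_above_tangent[of UNIV]) auto
  then show ?thesis
    by (simp add: \<phi>_def inner_diff_right)
qed

text \<open>Minimality of \<open>x\<close> against points of the segment from \<open>x\<close> to
  \<open>z\<close> yields the angle condition \<open>0 \<le> P\<close>. Expanding
  \<open>y - z\<close> around \<open>x\<close> then leaves \<open>Q\<close> plus nonnegative
  terms.\<close>

lemma is_wproj_nonexpansive:
  fixes F :: "(real^'d) set"
  assumes "convex F" and proj: "is_wproj F w y x" and z: "z \<in> F" and w: "\<And>i. 0 \<le> w $ i"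
  shows "(\<Sum>i\<in>UNIV. w$i * (x$i - z$i)^2) \<le> (\<Sum>i\<in>UNIV. w$i * (y$i - z$i)^2)"
proof -
  define P where "P = (\<Sum>i\<in>UNIV. w$i * ((x$i - y$i) * (z$i - x$i)))"
  define Q where "Q = (\<Sum>i\<in>UNIV. w$i * (z$i - x$i)^2)"
  have x: "x \<in> F" using proj by (simp add: is_wproj_def)
  have Q: "0 \<le> Q" unfolding Q_def by (intro sum_nonneg mult_nonneg_nonneg w) auto
  have step: "0 \<le> 2 * P + l * Q" if l: "0 < l" "l \<le> 1" for l
  proof -
    define v where "v = (1 - l) *\<^sub>R x + l *\<^sub>R z"
    have "v \<in> F"
      unfolding v_def using assms(1) x z l by (intro convexD) auto
    then have "(\<Sum>i\<in>UNIV. w$i * (x$i - y$i)^2) \<le> (\<Sum>i\<in>UNIV. w$i * (v$i - y$i)^2)"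
      using proj by (simp add: is_wproj_def)
    also have "\<dots> = (\<Sum>i\<in>UNIV. w$i * (x$i - y$i)^2 + l * (2 * (w$i * ((x$i - y$i) * (z$i - x$i))))
        + l * (l * (w$i * (z$i - x$i)^2)))"
      by (intro sum.cong) (auto simp: v_def power2_eq_square algebra_simps)
    also have "\<dots> = (\<Sum>i\<in>UNIV. w$i * (x$i - y$i)^2) + l * (2 * P) + l * (l * Q)"
      by (simp add: P_def Q_def sum.distrib sum_distrib_left)
    finally have "0 \<le> l * (2 * P + l * Q)" by (simp add: algebra_simps)
    then show ?thesis using l by (simp add: zero_le_mult_iff)
  qed
  have "0 \<le> P"
  proof (rule ccontr)
    assume "\<not> 0 \<le> P"
    then have P: "P < 0" by simp
    \<comment> \<open>This \<open>l\<close> is small enough for \<open>l * Q \<le> - P\<close>, so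
      that \<open>2 * P + l * Q \<le> P < 0\<close>. The denominator \<open>Q + 1\<close> covers
      \<open>Q = 0\<close>.\<close>
    define l where "l = min 1 (- P / (Q + 1))"
    have "0 < l" "l \<le> 1" using P Q by (auto simp: l_def divide_neg_pos)
    moreover have "l * Q \<le> - P"
    proof -
      have "l * Q \<le> l * (Q + 1)" using \<open>0 < l\<close> by simp
      also have "\<dots> \<le> (- P / (Q + 1)) * (Q + 1)"
        using Q by (intro mult_right_mono) (auto simp: l_def)
      finally show ?thesis using Q by simp
    qed
    ultimately show False using step[of l] P by linarith
  qed
  have "(\<Sum>i\<in>UNIV. w$i * (y$i - z$i)^2) = (\<Sum>i\<in>UNIV. w$i * (x$i - y$i)^2
      + 2 * (w$i * ((x$i - y$i) * (z$i - x$i))) + w$i * (z$i - x$i)^2)"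
    by (intro sum.cong) (auto simp: power2_eq_square algebra_simps)
  also have "\<dots> = (\<Sum>i\<in>UNIV. w$i * (x$i - y$i)^2) + 2 * P + Q"
    by (simp add: P_def Q_def sum.distrib sum_distrib_left)
  also have "\<dots> \<ge> Q"
    using \<open>0 \<le> P\<close> w by (simp add: sum_nonneg)
  finally show ?thesis
    by (simp add: Q_def power2_commute)
qed

section \<open>Weighted telescoping and the harmonic sum\<close>

lemma weighted_telescope_le:
  fixes w x :: "nat \<Rightarrow> real"
  assumes "1 \<le> T"
    and "\<And>t. t \<in> {1..T} \<Longrightarrow> 0 \<le> w t" and "\<And>t. t \<in> {1..<T} \<Longrightarrow> w t \<le> w (Suc t)"
    and "\<And>t. t \<in> {1..T} \<Longrightarrow> x t \<le> B"
  shows "(\<Sum>t=1..T. w t * (x t - x (Suc t))) \<le> w T * (B - x (Suc T))"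
  using assms
proof (induction T rule: dec_induct)
  case base
  then show ?case by (simp add: mult_left_mono)
next
  case (step n)
  have "(\<Sum>t=1..Suc n. w t * (x t - x (Suc t)))
      \<le> w n * (B - x (Suc n)) + w (Suc n) * (x (Suc n) - x (Suc (Suc n)))"
    using step by simp
  \<comment> \<open>The term \<open>- x (Suc T)\<close> kept in the bound makes the induction close:
    \<open>B - x (Suc n)\<close> is nonnegative, so its weight may be raised to
    \<open>w (Suc n)\<close>, after which \<open>x (Suc n)\<close> cancels.\<close>
  also have "\<dots> \<le> w (Suc n) * (B - x (Suc n)) + w (Suc n) * (x (Suc n) - x (Suc (Suc n)))"
    using step.prems step.hyps by (intro add_right_mono mult_right_mono) auto
  finally show ?case by (simp add: algebra_simps)
qed

lemma sum_inverse_le_ln: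
  assumes "1 \<le> n"
  shows "(\<Sum>t=1..n. 1 / real t) \<le> 1 + ln (real n)"
proof -
  obtain k where k: "n = Suc k" using assms by (cases n) auto
  \<comment> \<open>The difference between harmonic number and logarithm decreases, and its first
    value is 1.\<close>
  have "harm (Suc k) - ln (real (Suc k)) \<le> harm (Suc 0) - ln (real (Suc 0))"
    using decseqD[OF decseq_harm_diff_ln, of 0 k] by simp
  then show ?thesis
    by (simp add: k harm_def inverse_eq_divide)
qed

section \<open>Momentum estimates in a single coordinate\<close>

lemma convex_comb_power2_le:
  fixes a b l :: real
  assumes "0 \<le> l" "l \<le> 1"
  shows "(l * a + (1 - l) * b)^2 \<le> l * a^2 + (1 - l) * b^2"
proof -
  have "l * a^2 + (1 - l) * b^2 - (l * a + (1 - l) * b)^2 = l * (1 - l) * (a - b)^2"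
    by (simp add: power2_eq_square algebra_simps)
  moreover have "0 \<le> l * (1 - l) * (a - b)^2" using assms by simp
  ultimately show ?thesis by linarith
qed

lemma young_momentum:
  fixes a b g m m' x \<sigma> :: real
  assumes m: "m = b * m' + (1 - b) * g" and b: "0 \<le> b" "b < 1" and a: "0 < a" and \<sigma>: "0 < \<sigma>"
  shows "g * x + a / (2 * \<sigma>) * m^2
    \<le> m * x + a / (2 * \<sigma>) * (b * m'^2 + (1 - b) * g^2) + b * (\<sigma> * x^2 / (2 * a * (1 - b)))"
proof -
  \<comment> \<open>The Young parameter is chosen so that the \<open>(g - m')^2\<close> term becomes
    \<open>a / (2 * \<sigma>)\<close> times \<open>b * (1 - b) * (g - m')^2\<close>, the exact
    convexity gap \<open>b * m'^2 + (1 - b) * g^2 - m^2\<close>.\<close>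
  define p where "p = a * (1 - b) / \<sigma>"
  have p: "0 < p" using a b \<sigma> by (simp add: p_def)
  have "0 \<le> (p * (g - m') - x)^2 / (2 * p)"
    using p by simp
  also have "\<dots> = p / 2 * (g - m')^2 - (g - m') * x + x^2 / (2 * p)"
    using p by (simp add: field_simps power2_eq_square)
  finally have "b * ((g - m') * x) \<le> b * (p / 2 * (g - m')^2 + x^2 / (2 * p))"
    using b by (intro mult_left_mono) auto
  moreover have "x^2 / (2 * p) = \<sigma> * x^2 / (2 * a * (1 - b))"
    by (simp add: p_def mult_ac)
  moreover have "b * (p / 2 * (g - m')^2) = a / (2 * \<sigma>) * (b * (1 - b) * (g - m')^2)"
    by (simp add: p_def mult_ac)
  moreover have "b * (1 - b) * (g - m')^2 = (b * m'^2 + (1 - b) * g^2) - m^2"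
    unfolding m by (simp add: power2_eq_square algebra_simps)
  moreover have "g * x = m * x + b * ((g - m') * x)"
    unfolding m by (simp add: algebra_simps)
  ultimately show ?thesis
    by (simp only: distrib_left right_diff_distrib)
qed

text \<open>With \<open>q t\<close> the squared convex combination, convexity of squaring gives both
  \<open>m t^4 \<le> q t\<close> and \<open>q t \<le> B * m (t - 1)^4 + g t^4\<close>. After
  summation the momentum contributes at most \<open>B\<close> times the sum of \<open>q\<close>,
  which is absorbed on the left.\<close>

lemma momentum_fourth_power_sum_le:
  fixes b g m :: "nat \<Rightarrow> real"
  assumes m0: "m 0 = 0" and m: "\<And>t. t \<in> {1..T} \<Longrightarrow> m t = b t * m (t - 1) + (1 - b t) * g t"
    and b: "\<And>t. t \<in> {1..T} \<Longrightarrow> 0 \<le> b t \<and> b t \<le> B" and B: "0 \<le> B" "B < 1"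
  shows "(1 - B) * (\<Sum>t=1..T. (b t * m (t - 1)^2 + (1 - b t) * g t^2)^2) \<le> (\<Sum>t=1..T. g t^4)"
proof -
  define q where "q t = (b t * m (t - 1)^2 + (1 - b t) * g t^2)^2" for t
  have q0: "0 \<le> q t" for t by (simp add: q_def)
  have mq: "m t^4 \<le> q t" if "t \<in> {1..T}" for t
  proof -
    have "m t^2 \<le> b t * m (t - 1)^2 + (1 - b t) * g t^2"
      unfolding m[OF that] using b[OF that] B by (intro convex_comb_power2_le) auto
    then have "(m t^2)^2 \<le> q t" unfolding q_def by (intro power_mono) auto
    then show ?thesis by simp
  qed
  have qle: "q t \<le> B * m (t - 1)^4 + g t^4" if "t \<in> {1..T}" for t
  proof -
    have "q t \<le> b t * (m (t - 1)^2)^2 + (1 - b t) * (g t^2)^2"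
      unfolding q_def using b[OF that] B by (intro convex_comb_power2_le) auto
    also have "\<dots> \<le> B * (m (t - 1)^2)^2 + 1 * (g t^2)^2"
      using b[OF that] by (intro add_mono mult_right_mono) auto
    finally show ?thesis by simp
  qed
  have "(\<Sum>t=1..T. m (t - 1)^4) \<le> (\<Sum>t=1..T. q t)"
  proof (cases T)
    case (Suc n)
    \<comment> \<open>The shifted sum starts with \<open>m 0 = 0\<close>, so only indices 1 to
      \<open>n\<close> remain, where \<open>m t^4 \<le> q t\<close> is available.\<close>
    have "(\<Sum>t=1..T. m (t - 1)^4) = (\<Sum>t=0..n. m t^4)"
      unfolding Suc One_nat_def by (subst sum.shift_bounds_cl_Suc_ivl) simp
    also have "\<dots> = (\<Sum>t=1..n. m t^4)"
      by (simp add: sum.atLeast_Suc_atMost m0)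
    also have "\<dots> \<le> (\<Sum>t=1..n. q t)"
      using Suc by (intro sum_mono mq) auto
    also have "\<dots> \<le> (\<Sum>t=1..T. q t)"
      using Suc q0 by (intro sum_mono2) auto
    finally show ?thesis .
  qed simp
  then have "B * (\<Sum>t=1..T. m (t - 1)^4) \<le> B * (\<Sum>t=1..T. q t)"
    using B by (rule_tac mult_left_mono) auto
  moreover have "(\<Sum>t=1..T. q t) \<le> (\<Sum>t=1..T. B * m (t - 1)^4 + g t^4)"
    by (intro sum_mono qle)
  ultimately have "(1 - B) * (\<Sum>t=1..T. q t) \<le> (\<Sum>t=1..T. g t^4)"
    by (simp add: sum.distrib sum_distrib_left[symmetric] algebra_simps)
  then show ?thesis by (simp add: q_def)
qed

lemma momentum_weighted_sum_le:
  fixes b g m :: "nat \<Rightarrow> real"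
  assumes T: "1 \<le> T" and m0: "m 0 = 0"
    and m: "\<And>t. t \<in> {1..T} \<Longrightarrow> m t = b t * m (t - 1) + (1 - b t) * g t"
    and b: "\<And>t. t \<in> {1..T} \<Longrightarrow> 0 \<le> b t \<and> b t \<le> B" and B: "0 \<le> B" "B < 1"
  shows "(\<Sum>t=1..T. (b t * m (t - 1)^2 + (1 - b t) * g t^2) / sqrt (real t))
    \<le> (1 + B) / (1 - B)^3 * (sqrt (1 + ln (real T)) * sqrt (\<Sum>t=1..T. g t^4))"
proof -
  define q where "q t = b t * m (t - 1)^2 + (1 - b t) * g t^2" for t
  \<comment> \<open>\<open>K\<close> is the factor of the target bound. The estimate below asks only
    for \<open>1 / (1 - B) \<le> K^2\<close>, which follows from \<open>1 \<le> K\<close> and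
    \<open>1 / (1 - B) \<le> K\<close>.\<close>
  define K where "K = (1 + B) / (1 - B)^3"
  have "(1 - B)^3 \<le> 1" using B by (intro power_le_one) auto
  moreover have "(1 - B)^3 > 0" using B by simp
  ultimately have K1: "1 \<le> K"
    using B unfolding K_def by (subst le_divide_eq_1_pos) auto
  have Kinv: "1 / (1 - B) \<le> K"
  proof -
    have "(1 - B)^2 \<le> 1" using B by (intro power_le_one) auto
    then have "(1 - B)^2 \<le> 1 + B" using B by linarith
    then have "(1 - B)^2 / (1 - B)^3 \<le> K"
      unfolding K_def using B by (intro divide_right_mono) auto
    then show ?thesis using B by (simp add: power2_eq_square power3_eq_cube)
  qed
  have "(\<Sum>t=1..T. (q t)^2) \<le> 1 / (1 - B) * (\<Sum>t=1..T. g t^4)"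
    using momentum_fourth_power_sum_le[of m T b g B] assms
    by (simp add: q_def field_simps)
  also have "\<dots> \<le> K^2 * (\<Sum>t=1..T. g t^4)"
  proof (intro mult_right_mono sum_nonneg)
    have "K * 1 \<le> K * K" using K1 by (intro mult_left_mono) auto
    then show "1 / (1 - B) \<le> K^2" using Kinv by (simp add: power2_eq_square)
  qed auto
  finally have sq: "(\<Sum>t=1..T. (q t)^2) \<le> K^2 * (\<Sum>t=1..T. g t^4)" .
  have "(\<Sum>t=1..T. q t * (1 / sqrt (real t)))^2
      \<le> (\<Sum>t=1..T. (q t)^2) * (\<Sum>t=1..T. (1 / sqrt (real t))^2)"
    by (rule Cauchy_Schwarz_ineq_sum)
  also have "(\<Sum>t=1..T. (1 / sqrt (real t))^2) = (\<Sum>t=1..T. 1 / real t)"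
    by (simp add: power_divide)
  also have "(\<Sum>t=1..T. (q t)^2) * (\<Sum>t=1..T. 1 / real t)
      \<le> (K^2 * (\<Sum>t=1..T. g t^4)) * (1 + ln (real T))"
    using sq sum_inverse_le_ln[OF T] by (intro mult_mono) (auto intro!: sum_nonneg mult_nonneg_nonneg)
  finally have "(\<Sum>t=1..T. q t * (1 / sqrt (real t)))
      \<le> sqrt ((K^2 * (\<Sum>t=1..T. g t^4)) * (1 + ln (real T)))"
    by (rule real_le_rsqrt)
  then show ?thesis
    using K1 unfolding K_def[symmetric] by (simp add: real_sqrt_mult q_def mult_ac)
qed

section \<open>The regret bound\<close>

theorem theorem2p1:
  fixes F :: "(real^'d) set" and D G \<alpha> c \<beta>1 \<beta>2 \<epsilon> :: real and T :: nat
    and f :: "nat \<Rightarrow> real^'d \<Rightarrow> real"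
    and \<theta> g m s :: "nat \<Rightarrow> real^'d" and \<theta>s :: "real^'d"
    and \<beta>1t :: "nat \<Rightarrow> real"
  assumes F_convex: "convex F"
    and F_diam: "\<forall>x\<in>F. \<forall>y\<in>F. \<forall>i. \<bar>x$i - y$i\<bar> \<le> D"
    and f_convex: "\<forall>t\<in>{1..T}. convex_on UNIV (f t)"
    and f_diff: "\<forall>t\<in>{1..T}. \<forall>x. f t differentiable (at x)"
    and opt_mem: "\<theta>s \<in> F"
    and opt_min: "\<forall>x\<in>F. (\<Sum>t=1..T. f t \<theta>s) \<le> (\<Sum>t=1..T. f t x)"
    and init: "\<theta> 1 \<in> F" "m 0 = 0" "s 0 = 0"
    and grad: "\<forall>t\<in>{1..T}. (f t has_derivative (\<lambda>h. g t \<bullet> h)) (at (\<theta> t))"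
    and m_rec: "\<forall>t\<in>{1..T}. m t = \<beta>1t t *\<^sub>R m (t - 1) + (1 - \<beta>1t t) *\<^sub>R g t"
    and eps: "\<epsilon> \<ge> 0"
    and s_rec: "\<forall>t\<in>{1..T}. \<forall>i. s t $ i = \<beta>2 * s (t - 1) $ i + (1 - \<beta>2) * (g t $ i - m t $ i)^2 + \<epsilon>"
    and proj: "\<forall>t\<in>{1..T}. is_wproj F (\<chi> i. sqrt (s t $ i))
                 (\<chi> i. \<theta> t $ i - (\<alpha> / sqrt (real t)) * m t $ i / sqrt (s t $ i)) (\<theta> (Suc t))"
    and \<beta>2: "0 \<le> \<beta>2" "\<beta>2 < 1"
    and \<alpha>: "\<alpha> > 0"
    and \<beta>11: "\<beta>1t 1 = \<beta>1"
    and \<beta>1t: "\<forall>t\<in>{1..T}. 0 \<le> \<beta>1t t \<and> \<beta>1t t \<le> \<beta>1"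
    and \<beta>1: "\<beta>1 < 1"
    and s_mono: "\<forall>t\<in>{1..<T}. \<forall>i. s t $ i \<le> s (Suc t) $ i"
    and g_bound: "\<forall>t\<in>{1..T}. \<forall>i. \<bar>g t $ i\<bar> \<le> G / 2"
    and c: "c > 0"
    and s_lower: "\<forall>t\<in>{1..T}. \<forall>i. s t $ i \<ge> c"
  shows "(\<Sum>t=1..T. f t (\<theta> t) - f t \<theta>s)
    \<le> D^2 * sqrt (real T) / (2 * \<alpha> * (1 - \<beta>1)) * (\<Sum>i\<in>UNIV. sqrt (s T $ i))
     + (1 + \<beta>1) * \<alpha> * sqrt (1 + ln (real T)) / (2 * sqrt c * (1 - \<beta>1)^3)
         * (\<Sum>i\<in>UNIV. sqrt (\<Sum>t=1..T. (g t $ i)^4))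
     + D^2 / (2 * (1 - \<beta>1)) * (\<Sum>t=1..T. \<Sum>i\<in>UNIV. \<beta>1t t * sqrt (s t $ i) / (\<alpha> / sqrt (real t)))"
proof (cases "T = 0")
  \<comment> \<open>Every term on the right has a vanishing factor: \<open>sqrt 0\<close>, the root
    of an empty sum, or an empty sum.\<close>
  case True
  then show ?thesis by simp
next
  case False
  then have T: "1 \<le> T" by simp
  have B0: "0 \<le> \<beta>1" using \<beta>1t \<beta>11 T by force
  define a where "a t = \<alpha> / sqrt (real t)" for t
  define \<sigma> where "\<sigma> t i = sqrt (s t $ i)" for t i
  define x where "x t i = \<theta> t $ i - \<theta>s $ i" for t i
  define q where "q t i = \<beta>1t t * (m (t - 1) $ i)^2 + (1 - \<beta>1t t) * (g t $ i)^2" for t i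
  have a_pos: "0 < a t" if "t \<in> {1..T}" for t
    using that \<alpha> by (simp add: a_def)
  have \<sigma>_ge: "sqrt c \<le> \<sigma> t i" if "t \<in> {1..T}" for t i
    using s_lower that by (simp add: \<sigma>_def)
  have \<sigma>_pos: "0 < \<sigma> t i" if "t \<in> {1..T}" for t i
    using \<sigma>_ge[OF that, of i] c by (meson less_le_trans real_sqrt_gt_zero)
  have m_coord: "m t $ i = \<beta>1t t * m (t - 1) $ i + (1 - \<beta>1t t) * g t $ i" if "t \<in> {1..T}" for t i
    using m_rec that by simp
  have \<theta>_mem: "\<theta> t \<in> F" if "t \<in> {1..T}" for t
  proof (cases "t = 1")
    case True
    then show ?thesis using init by simp
  next
    case False
    \<comment> \<open>Each iterate after the first is the output of the projection at time
      \<open>t - 1\<close>.\<close>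
    then have "t - 1 \<in> {1..T}" "Suc (t - 1) = t" using that by auto
    then show ?thesis using proj unfolding is_wproj_def by metis
  qed
  have x_sq: "(x t i)^2 \<le> D^2" if "t \<in> {1..T}" for t i
    using F_diam \<theta>_mem[OF that] opt_mem power_mono[of "\<bar>x t i\<bar>" D 2] by (simp add: x_def)
  \<comment> \<open>The three summands per coordinate correspond to the three terms of the bound:
    the first telescopes in \<open>t\<close>, the second is handled by the momentum estimate, the
    third is already in final form.\<close>
  have main: "f t (\<theta> t) - f t \<theta>s \<le> (\<Sum>i\<in>UNIV. \<sigma> t i / (2 * a t) * ((x t i)^2 - (x (Suc t) i)^2)
      + a t / (2 * \<sigma> t i) * q t i + D^2 / (2 * (1 - \<beta>1)) * (\<beta>1t t * \<sigma> t i / a t))"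
    if t: "t \<in> {1..T}" for t
  proof -
    note at = a_pos[OF t] and \<sigma>t = \<sigma>_pos[OF t]
    have bt: "0 \<le> \<beta>1t t" "\<beta>1t t \<le> \<beta>1" "\<beta>1t t < 1" using \<beta>1t t \<beta>1 by force+
    have "(\<Sum>i\<in>UNIV. \<sigma> t i * (x (Suc t) i)^2) \<le> (\<Sum>i\<in>UNIV. \<sigma> t i * (x t i - a t * m t $ i / \<sigma> t i)^2)"
    proof -
      have "0 \<le> (\<chi> i. sqrt (s t $ i)) $ i" for i
        using \<sigma>t[of i] by (simp add: \<sigma>_def)
      from is_wproj_nonexpansive[OF F_convex proj[rule_format, OF t] opt_mem this]
      have "(\<Sum>i\<in>UNIV. \<sigma> t i * (x (Suc t) i)^2)
          \<le> (\<Sum>i\<in>UNIV. \<sigma> t i * ((\<theta> t $ i - a t * m t $ i / \<sigma> t i) - \<theta>s $ i)^2)"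
        by (simp add: \<sigma>_def x_def a_def)
      also have "\<dots> = (\<Sum>i\<in>UNIV. \<sigma> t i * (x t i - a t * m t $ i / \<sigma> t i)^2)"
        by (intro sum.cong refl) (simp add: x_def algebra_simps)
      finally show ?thesis .
    qed
    \<comment> \<open>The square is expanded with \<open>2 * a t\<close> factored out, since the
      inequality is divided by it next.\<close>
    also have "\<dots> = (\<Sum>i\<in>UNIV. \<sigma> t i * (x t i)^2 + 2 * a t * (a t / (2 * \<sigma> t i) * (m t $ i)^2 - m t $ i * x t i))"
      using \<sigma>t by (intro sum.cong refl) (simp add: field_simps power2_eq_square less_imp_neq[symmetric])
    finally have "0 \<le> (\<Sum>i\<in>UNIV. \<sigma> t i * (x t i)^2 - \<sigma> t i * (x (Suc t) i)^2
        + 2 * a t * (a t / (2 * \<sigma> t i) * (m t $ i)^2 - m t $ i * x t i))"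
      by (simp add: sum.distrib sum_subtractf)
    then have "0 \<le> 1 / (2 * a t) * (\<Sum>i\<in>UNIV. \<sigma> t i * (x t i)^2 - \<sigma> t i * (x (Suc t) i)^2
        + 2 * a t * (a t / (2 * \<sigma> t i) * (m t $ i)^2 - m t $ i * x t i))"
      using at by simp
    also have "\<dots> = (\<Sum>i\<in>UNIV. \<sigma> t i / (2 * a t) * ((x t i)^2 - (x (Suc t) i)^2)
        + (a t / (2 * \<sigma> t i) * (m t $ i)^2 - m t $ i * x t i))"
      unfolding sum_distrib_left using at
      by (intro sum.cong refl) (simp add: distrib_left diff_divide_distrib right_diff_distrib)
    finally have tele: "0 \<le> (\<Sum>i\<in>UNIV. \<sigma> t i / (2 * a t) * ((x t i)^2 - (x (Suc t) i)^2)
        + (a t / (2 * \<sigma> t i) * (m t $ i)^2 - m t $ i * x t i))" .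
    have young: "g t $ i * x t i \<le> m t $ i * x t i - a t / (2 * \<sigma> t i) * (m t $ i)^2
        + a t / (2 * \<sigma> t i) * q t i + D^2 / (2 * (1 - \<beta>1)) * (\<beta>1t t * \<sigma> t i / a t)" for i
    proof -
      \<comment> \<open>Passing to \<open>D\<close> and \<open>\<beta>1\<close> removes the
        dependence on the iterate and on \<open>\<beta>1t t\<close> from the Young
        remainder.\<close>
      have "\<sigma> t i * (x t i)^2 / (2 * a t * (1 - \<beta>1t t)) \<le> \<sigma> t i * D^2 / (2 * a t * (1 - \<beta>1))"
        using x_sq[OF t, of i] at \<sigma>t[of i] bt \<beta>1
        by (intro frac_le mult_left_mono) auto
      then have "\<beta>1t t * (\<sigma> t i * (x t i)^2 / (2 * a t * (1 - \<beta>1t t)))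
          \<le> \<beta>1t t * (\<sigma> t i * D^2 / (2 * a t * (1 - \<beta>1)))"
        using bt by (intro mult_left_mono)
      also have "\<dots> = D^2 / (2 * (1 - \<beta>1)) * (\<beta>1t t * \<sigma> t i / a t)"
        by (simp add: mult_ac)
      finally show ?thesis
        using young_momentum[OF m_coord[OF t] bt(1,3) at \<sigma>t, of i "x t i" i]
        unfolding q_def by linarith
    qed
    have "f t (\<theta> t) - f t \<theta>s \<le> g t \<bullet> (\<theta> t - \<theta>s)"
      using f_convex grad t by (intro convex_on_ge_tangent) auto
    also have "\<dots> = (\<Sum>i\<in>UNIV. g t $ i * x t i)"
      by (simp add: inner_vec_def x_def)
    also have "\<dots> \<le> (\<Sum>i\<in>UNIV. m t $ i * x t i - a t / (2 * \<sigma> t i) * (m t $ i)^2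
        + a t / (2 * \<sigma> t i) * q t i + D^2 / (2 * (1 - \<beta>1)) * (\<beta>1t t * \<sigma> t i / a t))"
      by (intro sum_mono young)
    \<comment> \<open>Adding the nonnegative sum \<open>tele\<close> cancels
      \<open>m t $ i * x t i\<close> and the \<open>(m t $ i)^2\<close> term, leaving the difference
      of squares.\<close>
    also have "\<dots> \<le> \<dots> + (\<Sum>i\<in>UNIV. \<sigma> t i / (2 * a t) * ((x t i)^2 - (x (Suc t) i)^2)
        + (a t / (2 * \<sigma> t i) * (m t $ i)^2 - m t $ i * x t i))"
      using tele by simp
    also have "\<dots> = (\<Sum>i\<in>UNIV. \<sigma> t i / (2 * a t) * ((x t i)^2 - (x (Suc t) i)^2)
      + a t / (2 * \<sigma> t i) * q t i + D^2 / (2 * (1 - \<beta>1)) * (\<beta>1t t * \<sigma> t i / a t))"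
      unfolding sum.distrib[symmetric] by (intro sum.cong refl) linarith
    finally show ?thesis .
  qed
  have first: "(\<Sum>t=1..T. \<sigma> t i / (2 * a t) * ((x t i)^2 - (x (Suc t) i)^2))
      \<le> D^2 * sqrt (real T) / (2 * \<alpha> * (1 - \<beta>1)) * \<sigma> T i" for i
  proof -
    have nn: "0 \<le> \<sigma> T i / (2 * a T)"
      using \<sigma>_pos[of T i] a_pos[of T] T by simp
    have "(\<Sum>t=1..T. \<sigma> t i / (2 * a t) * ((x t i)^2 - (x (Suc t) i)^2))
        \<le> \<sigma> T i / (2 * a T) * (D^2 - (x (Suc T) i)^2)"
    proof (rule weighted_telescope_le[OF T])
      fix t assume t: "t \<in> {1..<T}"
      \<comment> \<open>The weight equals
        \<open>\<sigma> t i * sqrt (real t) / (2 * \<alpha>)\<close>, a product of two nondecreasing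
        factors up to a constant.\<close>
      have "\<sigma> t i * sqrt (real t) \<le> \<sigma> (Suc t) i * sqrt (real (Suc t))"
        using s_mono t \<sigma>_pos[of t i] \<sigma>_pos[of "Suc t" i] by (intro mult_mono) (auto simp: \<sigma>_def)
      then show "\<sigma> t i / (2 * a t) \<le> \<sigma> (Suc t) i / (2 * a (Suc t))"
        using \<alpha> unfolding a_def by (simp add: divide_right_mono)
    qed (use \<sigma>_pos a_pos x_sq in \<open>auto intro!: divide_nonneg_nonneg less_imp_le\<close>)
    also have "\<dots> \<le> \<sigma> T i / (2 * a T) * D^2"
      using nn by (intro mult_left_mono) auto
    \<comment> \<open>Telescoping produces no factor \<open>1 / (1 - \<beta>1)\<close>; it is at
      least 1 and is inserted to match the stated bound.\<close>
    also have "\<dots> \<le> \<sigma> T i / (2 * a T) * D^2 / (1 - \<beta>1)"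
      using divide_left_mono[of "1 - \<beta>1" 1 "\<sigma> T i / (2 * a T) * D^2"]
        mult_nonneg_nonneg[OF nn zero_le_power2[of D]] B0 \<beta>1 by simp
    also have "\<dots> = D^2 * sqrt (real T) / (2 * \<alpha> * (1 - \<beta>1)) * \<sigma> T i"
      by (simp add: a_def mult_ac)
    finally show ?thesis .
  qed
  have second: "(\<Sum>t=1..T. a t / (2 * \<sigma> t i) * q t i)
      \<le> (1 + \<beta>1) * \<alpha> * sqrt (1 + ln (real T)) / (2 * sqrt c * (1 - \<beta>1)^3) * sqrt (\<Sum>t=1..T. (g t $ i)^4)" for i
  proof -
    have "(\<Sum>t=1..T. a t / (2 * \<sigma> t i) * q t i) \<le> (\<Sum>t=1..T. \<alpha> / (2 * sqrt c) * (q t i / sqrt (real t)))"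
    proof (intro sum_mono)
      fix t assume t: "t \<in> {1..T}"
      have "0 \<le> q t i" using \<beta>1t t \<beta>1 unfolding q_def
        by (intro add_nonneg_nonneg mult_nonneg_nonneg) force+
      \<comment> \<open>The lower bound \<open>c\<close> makes the coefficient uniform in
        \<open>s\<close>, leaving only the decay \<open>1 / sqrt (real t)\<close> for the momentum
        estimate.\<close>
      moreover have "a t / (2 * \<sigma> t i) \<le> a t / (2 * sqrt c)"
        using \<sigma>_ge[OF t, of i] \<sigma>_pos[OF t, of i] a_pos[OF t] c by (intro divide_left_mono) auto
      ultimately have "a t / (2 * \<sigma> t i) * q t i \<le> a t / (2 * sqrt c) * q t i"
        by (intro mult_right_mono)
      then show "a t / (2 * \<sigma> t i) * q t i \<le> \<alpha> / (2 * sqrt c) * (q t i / sqrt (real t))"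
        by (simp add: a_def mult_ac)
    qed
    also have "\<dots> = \<alpha> / (2 * sqrt c) * (\<Sum>t=1..T. q t i / sqrt (real t))"
      by (rule sum_distrib_left[symmetric])
    also have "\<dots> \<le> \<alpha> / (2 * sqrt c) *
        ((1 + \<beta>1) / (1 - \<beta>1)^3 * (sqrt (1 + ln (real T)) * sqrt (\<Sum>t=1..T. (g t $ i)^4)))"
      unfolding q_def
      using momentum_weighted_sum_le[OF T, of "\<lambda>t. m t $ i" \<beta>1t "\<lambda>t. g t $ i" \<beta>1]
        init(2) m_coord \<beta>1t B0 \<beta>1 \<alpha> c
      by (intro mult_left_mono) auto
    also have "\<dots> = (1 + \<beta>1) * \<alpha> * sqrt (1 + ln (real T)) / (2 * sqrt c * (1 - \<beta>1)^3)
        * sqrt (\<Sum>t=1..T. (g t $ i)^4)"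
      by (simp add: mult_ac)
    finally show ?thesis .
  qed
  have "(\<Sum>t=1..T. f t (\<theta> t) - f t \<theta>s)
      \<le> (\<Sum>t=1..T. \<Sum>i\<in>UNIV. \<sigma> t i / (2 * a t) * ((x t i)^2 - (x (Suc t) i)^2)
        + a t / (2 * \<sigma> t i) * q t i + D^2 / (2 * (1 - \<beta>1)) * (\<beta>1t t * \<sigma> t i / a t))"
    by (intro sum_mono main)
  \<comment> \<open>The first two terms are bounded over time for each fixed coordinate, hence the
    exchange of sums; the third keeps the order of the statement.\<close>
  also have "\<dots> = (\<Sum>i\<in>UNIV. \<Sum>t=1..T. \<sigma> t i / (2 * a t) * ((x t i)^2 - (x (Suc t) i)^2))
      + (\<Sum>i\<in>UNIV. \<Sum>t=1..T. a t / (2 * \<sigma> t i) * q t i)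
      + D^2 / (2 * (1 - \<beta>1)) * (\<Sum>t=1..T. \<Sum>i\<in>UNIV. \<beta>1t t * \<sigma> t i / a t)"
    unfolding sum.distrib sum_distrib_left
    by (simp only: sum.swap[of _ UNIV "{1..T}"])
  also have "\<dots> \<le> (\<Sum>i\<in>UNIV. D^2 * sqrt (real T) / (2 * \<alpha> * (1 - \<beta>1)) * \<sigma> T i)
      + (\<Sum>i\<in>UNIV. (1 + \<beta>1) * \<alpha> * sqrt (1 + ln (real T)) / (2 * sqrt c * (1 - \<beta>1)^3)
          * sqrt (\<Sum>t=1..T. (g t $ i)^4))
      + D^2 / (2 * (1 - \<beta>1)) * (\<Sum>t=1..T. \<Sum>i\<in>UNIV. \<beta>1t t * \<sigma> t i / a t)"
    by (intro add_mono sum_mono first second order_refl)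
  finally show ?thesis
    unfolding sum_distrib_left[symmetric] \<sigma>_def a_def .
qed

end
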